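(* Let $m,n\ge 1$ be integers and let $r$ be an integer such that $\gcd(m,n)=\gcd(m,r-1)=1$ and $r^n\equiv 1\pmod m$. Let $\mathrm{ZM}(m,n,r)=\langle a,b\mid a^m=b^n=1,\ b^{-1}ab=a^r\rangle$, and let $d=\min\{k\ge 1\mid r^k\equiv 1\pmod m\}$ be the multiplicative order of $r$ modulo $m$. If $m$ is a prime, then $$|N(\mathrm{ZM}(m,n,r))|=\tau(n)+\tau\!\left(\frac{n}{d}\right).$$ If $n$ is a prime, then $$|N(\mathrm{ZM}(m,n,r))|=\tau(m)+1.$$
   Context: For a group $G$, $N(G)$ denotes the lattice (set) of all normal subgroups of $G$. For a positive integer $k$, $\tau(k)$ denotes the number of distinct positive divisors of $k$. The group $\mathrm{ZM}(m,n,r)$ (a ZM-group, i.e. a finite group all of whose Sylow subgroups are cyclic) has order $mn$. *)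

theory Defs
  imports "HOL-Algebra.Coset" "HOL-Number_Theory.Cong"
begin

text \<open>
  A letter \<open>(x, True)\<close> stands for the generator \<open>x\<close>, and \<open>(x, False)\<close> for its formal inverse.
\<close>

type_synonym 'x word = "('x \<times> bool) list"

definition gen_pow :: "'x \<Rightarrow> int \<Rightarrow> 'x word" where
  "gen_pow x k = replicate (nat \<bar>k\<bar>) (x, k \<ge> 0)"

inductive_set word_cong :: "('x word \<times> 'x word) set \<Rightarrow> ('x word \<times> 'x word) set"
  for R :: "('x word \<times> 'x word) set" where
  rel: "(u, v) \<in> R \<Longrightarrow> (u, v) \<in> word_cong R"
| cancel: "([(x, e), (x, \<not> e)], []) \<in> word_cong R"
| refl: "(u, u) \<in> word_cong R"
| sym: "(u, v) \<in> word_cong R \<Longrightarrow> (v, u) \<in> word_cong R"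
| trans: "(u, v) \<in> word_cong R \<Longrightarrow> (v, w) \<in> word_cong R \<Longrightarrow> (u, w) \<in> word_cong R"
| append: "(u, u') \<in> word_cong R \<Longrightarrow> (v, v') \<in> word_cong R \<Longrightarrow> (u @ v, u' @ v') \<in> word_cong R"

text \<open>
  The group presented by all elements of the type \<open>'x\<close> as generators, subject to the
  relations \<open>u = v\<close> for \<open>(u, v) \<in> R\<close>.
\<close>

definition presented_group :: "('x word \<times> 'x word) set \<Rightarrow> 'x word set monoid" where
  "presented_group R =
    \<lparr>carrier = UNIV // word_cong R,
     monoid.mult = (\<lambda>A B. \<Union>u\<in>A. \<Union>v\<in>B. word_cong R `` {u @ v}),
     one = word_cong R `` {[]}\<rparr>"

lemma equiv_word_cong: "equiv UNIV (word_cong R)"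
  by (intro equivI refl_onI symI transI)
     (auto intro: word_cong.refl word_cong.sym word_cong.trans)

lemma mult_presented_group:
  "(word_cong R `` {u}) \<otimes>\<^bsub>presented_group R\<^esub> (word_cong R `` {v}) = word_cong R `` {u @ v}"
proof -
  have "(\<lambda>u v. word_cong R `` {u @ v}) respects2 word_cong R"
    by (intro congruent2I' equiv_class_eq[OF equiv_word_cong] word_cong.append)
  then show ?thesis
    by (simp add: presented_group_def UN_equiv_class2[OF equiv_word_cong equiv_word_cong])
qed

lemma word_inverse:
  "(map (\<lambda>(x, e). (x, \<not> e)) (rev u) @ u, []) \<in> word_cong R"
proof (induction u)
  case Nil
  show ?case by (simp add: word_cong.refl)
next
  case (Cons p u)
  obtain x e where p: "p = (x, e)" by force
  let ?i = "map (\<lambda>(x, e). (x, \<not> e)) (rev u)"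
  have "([(x, \<not> e), (x, e)], []) \<in> word_cong R"
    using word_cong.cancel[of x "\<not> e" R] by simp
  then have "(?i @ [(x, \<not> e), (x, e)] @ u, ?i @ [] @ u) \<in> word_cong R"
    by (intro word_cong.append word_cong.refl)
  then show ?case
    using Cons.IH p by (auto intro: word_cong.trans)
qed

lemma group_presented_group: "group (presented_group R)"
proof (rule groupI)
  let ?G = "presented_group R" and ?c = "\<lambda>u. word_cong R `` {u}"
  have one: "\<one>\<^bsub>?G\<^esub> = ?c []" by (simp add: presented_group_def)
  have cls: "\<exists>u. A = ?c u" if "A \<in> carrier ?G" for A
    using that by (auto simp: presented_group_def quotient_def)
  have mem: "?c u \<in> carrier ?G" for u
    by (simp add: presented_group_def quotientI)
  show "A \<otimes>\<^bsub>?G\<^esub> B \<in> carrier ?G" if "A \<in> carrier ?G" "B \<in> carrier ?G" for A B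
    using cls[OF that(1)] cls[OF that(2)] mem by (auto simp: mult_presented_group)
  show "\<one>\<^bsub>?G\<^esub> \<in> carrier ?G" by (simp add: one mem)
  show "(A \<otimes>\<^bsub>?G\<^esub> B) \<otimes>\<^bsub>?G\<^esub> C = A \<otimes>\<^bsub>?G\<^esub> (B \<otimes>\<^bsub>?G\<^esub> C)"
    if "A \<in> carrier ?G" "B \<in> carrier ?G" "C \<in> carrier ?G" for A B C
    using cls[OF that(1)] cls[OF that(2)] cls[OF that(3)] by (auto simp: mult_presented_group)
  show "\<one>\<^bsub>?G\<^esub> \<otimes>\<^bsub>?G\<^esub> A = A" if "A \<in> carrier ?G" for A
    using cls[OF that] by (auto simp: one mult_presented_group)
  show "\<exists>B\<in>carrier ?G. B \<otimes>\<^bsub>?G\<^esub> A = \<one>\<^bsub>?G\<^esub>" if A: "A \<in> carrier ?G" for A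
  proof -
    obtain u where u: "A = ?c u" using cls[OF A] by blast
    have "?c (map (\<lambda>(x, e). (x, \<not> e)) (rev u)) \<otimes>\<^bsub>?G\<^esub> A = \<one>\<^bsub>?G\<^esub>"
      unfolding u one mult_presented_group
      by (intro equiv_class_eq[OF equiv_word_cong] word_inverse)
    then show ?thesis using mem by blast
  qed
qed

definition word_eval :: "('g, 'h) monoid_scheme \<Rightarrow> ('x \<Rightarrow> 'g) \<Rightarrow> 'x word \<Rightarrow> 'g" where
  "word_eval G f w =
    foldr (\<lambda>(x, e) g. (if e then f x else inv\<^bsub>G\<^esub> f x) \<otimes>\<^bsub>G\<^esub> g) w \<one>\<^bsub>G\<^esub>"

lemma (in group) word_eval_closed:
  assumes "\<And>x. f x \<in> carrier G"
  shows "word_eval G f w \<in> carrier G"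
  using assms by (induction w) (auto simp: word_eval_def)

lemma (in group) word_eval_append:
  assumes "\<And>x. f x \<in> carrier G"
  shows "word_eval G f (u @ v) = word_eval G f u \<otimes> word_eval G f v"
proof (induction u)
  case Nil
  show ?case using word_eval_closed[of f v] assms by (simp add: word_eval_def)
next
  case (Cons p u)
  obtain x e where p: "p = (x, e)" by force
  have *: "word_eval G f (p # w) = (if e then f x else inv f x) \<otimes> word_eval G f w" for w
    by (simp add: word_eval_def p)
  have "(if e then f x else inv f x) \<in> carrier G" using assms by simp
  then show ?case
    using Cons.IH word_eval_closed[of f] assms
    by (simp only: append_Cons * m_assoc)
qed

lemma (in group) word_eval_cong:
  assumes f: "\<And>x. f x \<in> carrier G"
    and R: "\<And>u v. (u, v) \<in> R \<Longrightarrow> word_eval G f u = word_eval G f v"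
    and "(u, v) \<in> word_cong R"
  shows "word_eval G f u = word_eval G f v"
  using assms(3)
proof induction
  case (cancel x e)
  then show ?case using f[of x] by (cases e) (simp_all add: word_eval_def)
qed (simp_all add: R word_eval_append f)

lemma (in group) presented_group_universal:
  assumes f: "\<And>x. f x \<in> carrier G"
    and R: "\<And>u v. (u, v) \<in> R \<Longrightarrow> word_eval G f u = word_eval G f v"
  shows "\<exists>h \<in> hom (presented_group R) G. \<forall>w. h (word_cong R `` {w}) = word_eval G f w"
proof -
  define h where "h A = word_eval G f (SOME u. u \<in> A)" for A
  have h: "h (word_cong R `` {w}) = word_eval G f w" for w
  proof -
    have "(SOME u. u \<in> word_cong R `` {w}) \<in> word_cong R `` {w}"
      by (rule someI[of _ w]) (simp add: word_cong.refl)
    then have "(w, SOME u. u \<in> word_cong R `` {w}) \<in> word_cong R" by simp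
    from word_eval_cong[OF f R this] show ?thesis by (simp add: h_def)
  qed
  have cls: "\<exists>u. A = word_cong R `` {u}" if "A \<in> carrier (presented_group R)" for A
    using that by (auto simp: presented_group_def quotient_def)
  have "h \<in> hom (presented_group R) G"
  proof (rule homI)
    show "h A \<in> carrier G" if "A \<in> carrier (presented_group R)" for A
      using cls[OF that] word_eval_closed[OF f] h by auto
    show "h (A \<otimes>\<^bsub>presented_group R\<^esub> B) = h A \<otimes> h B"
      if "A \<in> carrier (presented_group R)" "B \<in> carrier (presented_group R)" for A B
      using cls[OF that(1)] cls[OF that(2)]
      by (auto simp: mult_presented_group h word_eval_append[OF f])
  qed
  with h show ?thesis by blast
qed

datatype zm_gen = Gen_a | Gen_b

definition ZM :: "nat \<Rightarrow> nat \<Rightarrow> int \<Rightarrow> zm_gen word set monoid" where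
  "ZM m n r = presented_group
    {(gen_pow Gen_a (int m), []),
     (gen_pow Gen_b (int n), []),
     (gen_pow Gen_b (-1) @ gen_pow Gen_a 1 @ gen_pow Gen_b 1, gen_pow Gen_a r)}"

definition normal_subgroups :: "('g, 'h) monoid_scheme \<Rightarrow> 'g set set" where
  "normal_subgroups G = {H. H \<lhd> G}"

definition tau :: "nat \<Rightarrow> nat" where
  "tau k = card {e. e dvd k}"

end

theory Submission
  imports Defs
begin

text \<open>
  Every element of the group is of the form \<open>b\<^sup>j a\<^sup>i\<close>.  If \<open>N\<close> is normal and contains
  \<open>x = b\<^sup>j a\<^sup>i\<close>, then the commutator of \<open>x\<close> with \<open>b\<close> yields \<open>a\<close> to the power \<open>i (r - 1)\<close>, and
  since \<open>r - 1\<close> is a unit modulo \<open>m\<close>, both \<open>a\<^sup>i\<close> and \<open>b\<^sup>j\<close> lie in \<open>N\<close>.  The commutator of \<open>b\<^sup>j\<close> with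
  \<open>a\<close> yields \<open>a\<close> to the power \<open>r\<^sup>j - 1\<close>.  Hence the normal subgroups are exactly the sets
  \<open>{b\<^sup>j a\<^sup>i | e dvd j, f dvd i}\<close> with \<open>e dvd n\<close>, \<open>f dvd m\<close> and \<open>f dvd r\<^sup>e - 1\<close>.  It remains
  to count such pairs \<open>(e, f)\<close>.
\<close>

section \<open>Periods, powers and subgroup membership\<close>

text \<open>By \<open>add\<close>, \<open>P\<close> is invariant under translation by the least
  positive index \<open>e\<close> satisfying it, so \<open>P j\<close> reduces to
  \<open>P (j mod e)\<close>, and minimality of \<open>e\<close> excludes a nonzero remainder. This
  serves both for exponents of powers lying in a subgroup and for the multiplicative order of
  \<open>r\<close>.\<close>

lemma Least_period_dvd_iff:
  fixes P :: "nat \<Rightarrow> bool"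
  assumes add: "\<And>i j. P i \<Longrightarrow> P (i + j) \<longleftrightarrow> P j"
    and n: "n \<ge> 1" "P n"
  shows "P j \<longleftrightarrow> (LEAST k. k \<ge> 1 \<and> P k) dvd j"
proof -
  define e where "e = (LEAST k. k \<ge> 1 \<and> P k)"
  have e: "e \<ge> 1" "P e"
    unfolding e_def using LeastI[of "\<lambda>k. k \<ge> 1 \<and> P k" n] n by auto
  have mult: "P (q * e + j) \<longleftrightarrow> P j" for q j
    by (induction q) (use add[OF e(2)] in \<open>auto simp: add.assoc\<close>)
  have "P j \<longleftrightarrow> P (j mod e)"
    using mult[of "j div e" "j mod e"] by simp
  moreover have "P (j mod e) \<longleftrightarrow> j mod e = 0"
  proof
    assume "P (j mod e)"
    moreover have "j mod e < e" using e(1) by simp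
    ultimately show "j mod e = 0"
      unfolding e_def by (metis (mono_tags, lifting) not_less_Least less_one linorder_not_less)
  next
    assume "j mod e = 0"
    then show "P (j mod e)" using add[OF n(2), of 0] n(2) by simp
  qed
  ultimately show ?thesis by (simp add: e_def dvd_eq_mod_eq_0)
qed

lemma ex_period_dvd_iff:
  fixes P :: "nat \<Rightarrow> bool"
  assumes "\<And>i j. P i \<Longrightarrow> P (i + j) \<longleftrightarrow> P j" and "n \<ge> 1" and "P n"
  obtains e where "e dvd n" and "\<And>j. P j \<longleftrightarrow> e dvd j"
  using Least_period_dvd_iff[of P n] assms by blast

lemma dvd_power_minus_one_of_dvd:
  fixes r f :: int
  assumes "f dvd r ^ e - 1" and "e dvd j"
  shows "f dvd r ^ j - 1"
proof -
  obtain k where k: "j = e * k" using assms(2) by blast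
  have "[(r ^ e) ^ k = 1 ^ k] (mod f)"
    by (intro cong_pow) (simp add: assms(1) cong_iff_dvd_diff)
  then show ?thesis by (simp add: k power_mult cong_iff_dvd_diff)
qed

lemma (in group) subgroup_mult_left_iff:
  assumes "subgroup H G" and "x \<in> H" and "y \<in> carrier G"
  shows "x \<otimes> y \<in> H \<longleftrightarrow> y \<in> H"
proof
  assume "x \<otimes> y \<in> H"
  then have "inv x \<otimes> (x \<otimes> y) \<in> H"
    using assms by (blast intro: subgroup.m_closed subgroup.m_inv_closed)
  then show "y \<in> H"
    using assms by (metis inv_solve_left' m_closed subgroup.mem_carrier)
qed (use assms in \<open>simp add: subgroup.m_closed\<close>)

section \<open>Groups satisfying the defining relations\<close>

text \<open>Only the relations, with no claim of faithfulness, so that both the presented group and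
  a concrete model are instances: the first to obtain normal forms, the second as the target of a
  homomorphism.\<close>

locale zm_relations = group G for G (structure) +
  fixes a b and m n :: nat and r :: int
  assumes a_closed [simp]: "a \<in> carrier G" and b_closed [simp]: "b \<in> carrier G"
    and m_pos: "m \<ge> 1" and n_pos: "n \<ge> 1"
    and pow_a: "a [^] m = \<one>" and pow_b: "b [^] n = \<one>"
    and conj: "inv b \<otimes> a \<otimes> b = a [^] r"
begin

text \<open>The normal form. The exponent of \<open>b\<close> is a natural number because moving
  \<open>a\<close> past \<open>b [^] j\<close> multiplies its exponent by the integer
  \<open>r ^ j\<close>.\<close>

definition el :: "nat \<Rightarrow> int \<Rightarrow> 'a" where
  "el j i = b [^] j \<otimes> a [^] i"

lemma el_closed [simp]: "el j i \<in> carrier G"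
  by (simp add: el_def)

lemma pow_a_dvd: "int m dvd i \<Longrightarrow> a [^] i = \<one>"
  by (auto simp: dvd_def int_pow_pow[symmetric] int_pow_int pow_a)

lemma pow_b_dvd: "n dvd j \<Longrightarrow> b [^] j = \<one>"
  by (auto simp: dvd_def nat_pow_pow[symmetric] pow_b)

lemma pow_a_cong: "[i = k] (mod int m) \<Longrightarrow> a [^] i = a [^] k"
  using pow_a_dvd[of "i - k"] by (simp add: cong_iff_dvd_diff int_pow_diff inv_solve_right')

lemma commute: "a [^] (i::int) \<otimes> b [^] (j::nat) = b [^] j \<otimes> a [^] (i * r ^ j)"
proof (induction j arbitrary: i)
  case (Suc j)
  \<comment> \<open>Conjugation by \<open>b\<close> is multiplicative, so it sends each power of
    \<open>a\<close> to the same power of \<open>a [^] r\<close>; negative exponents follow by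
    inverting.\<close>
  have b: "a [^] i \<otimes> b = b \<otimes> a [^] (i * r)" for i :: int
  proof -
    have cj: "inv b \<otimes> x \<otimes> b \<otimes> (inv b \<otimes> y \<otimes> b) = inv b \<otimes> (x \<otimes> y) \<otimes> b"
      if "x \<in> carrier G" "y \<in> carrier G" for x y
      using that by (simp add: m_assoc) (simp add: m_assoc[symmetric])
    have nat: "inv b \<otimes> a [^] (k::nat) \<otimes> b = (a [^] r) [^] k" for k
      by (induction k) (auto simp: conj cj[symmetric])
    have "inv b \<otimes> a [^] i \<otimes> b = a [^] (i * r)"
    proof (cases "i \<ge> 0")
      case True
      with nat[of "nat i"] show ?thesis
        by (metis a_closed int_nat_eq int_pow_int int_pow_pow mult.commute)
    next
      case False
      then have i: "i = - int (nat (- i))" by simp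
      have "inv (inv b \<otimes> a [^] nat (- i) \<otimes> b) = inv ((a [^] r) [^] nat (- i))"
        by (simp only: nat)
      then show ?thesis
        by (subst (1 2) i)
          (simp add: inv_mult_group m_assoc int_pow_neg_int int_pow_neg int_pow_pow
            mult.commute flip: int_pow_int)
    qed
    then show ?thesis
      by (simp add: m_assoc inv_solve_left')
  qed
  show ?case
    by (simp add: m_assoc[symmetric] Suc) (simp add: m_assoc b mult_ac)
qed simp

lemma el_mult: "el j i \<otimes> el l k = el (j + l) (i * r ^ l + k)"
proof -
  have "el j i \<otimes> el l k = b [^] j \<otimes> (a [^] i \<otimes> b [^] l) \<otimes> a [^] k"
    by (simp add: el_def m_assoc)
  also have "\<dots> = b [^] j \<otimes> b [^] l \<otimes> (a [^] (i * r ^ l) \<otimes> a [^] k)"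
    by (simp add: commute m_assoc)
  finally show ?thesis
    by (simp add: el_def int_pow_mult nat_pow_mult)
qed

lemma el_eq_one: "n dvd j \<Longrightarrow> int m dvd i \<Longrightarrow> el j i = \<one>"
  by (simp add: el_def pow_a_dvd pow_b_dvd)

text \<open>The number \<open>j * (n - 1)\<close> plays the role of \<open>- j\<close>, since adding
  \<open>j\<close> gives the multiple \<open>j * n\<close> of \<open>n\<close>. This keeps the
  exponent of \<open>b\<close> natural.\<close>

lemma inv_el: "inv (el j i) = el (j * (n - 1)) (- i * r ^ (j * (n - 1)))"
proof -
  have "j + j * (n - 1) = j * n"
    using n_pos by (cases n) auto
  then have "el j i \<otimes> el (j * (n - 1)) (- i * r ^ (j * (n - 1))) = \<one>"
    by (simp add: el_mult el_eq_one)
  then show ?thesis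
    by (metis inv_equality inv_inv el_closed)
qed

text \<open>Normal forms are closed under products and inverses, so induction on the word suffices.
  In a group generated by \<open>a\<close> and \<open>b\<close> this puts every element in normal
  form.\<close>

lemma word_eval_eq_el: "\<exists>j i. word_eval G (case_zm_gen a b) w = el j i"
proof (induction w)
  case Nil
  have "word_eval G (case_zm_gen a b) [] = el 0 0" by (simp add: word_eval_def el_eq_one)
  then show ?case by blast
next
  case (Cons p w)
  obtain x e where p: "p = (x, e)" by force
  have "a = el 0 1" "b = el 1 0" by (simp_all add: el_def)
  then obtain j i where ji: "case_zm_gen a b x = el j i"
    by (cases x) auto
  then have "\<exists>j i. (if e then case_zm_gen a b x else inv (case_zm_gen a b x)) = el j i"
    by (auto simp: inv_el)
  then obtain j' i' where "(if e then case_zm_gen a b x else inv (case_zm_gen a b x)) = el j' i'"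
    by blast
  moreover obtain l k where "word_eval G (case_zm_gen a b) w = el l k"
    using Cons.IH by blast
  ultimately have "word_eval G (case_zm_gen a b) (p # w) = el (j' + l) (i' * r ^ l + k)"
    by (simp add: p word_eval_def el_mult)
  then show ?case by blast
qed

end

section \<open>Normal subgroups of a ZM-group\<close>

text \<open>Faithfulness is added to the relations: normal forms exhaust the group, and
  \<open>el j i\<close> is trivial only when \<open>n\<close> divides \<open>j\<close> and
  \<open>m\<close> divides \<open>i\<close>, which amounts to order \<open>m * n\<close>.\<close>

locale zm_group = zm_relations +
  assumes carrier_el: "x \<in> carrier G \<Longrightarrow> \<exists>j i. x = el j i"
    and el_one_imp: "el j i = \<one> \<Longrightarrow> n dvd j \<and> int m dvd i"
    and coprime_r: "coprime (int m) (r - 1)"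
    and r_pow: "[r ^ n = 1] (mod int m)"
begin

definition sub :: "nat \<Rightarrow> nat \<Rightarrow> 'a set" where
  "sub e f = {el j i | j i. e dvd j \<and> int f dvd i}"

text \<open>Two normal forms of one element have exponents congruent modulo \<open>n\<close> and
  \<open>m\<close>. As \<open>e\<close> divides \<open>n\<close> and \<open>f\<close> divides
  \<open>m\<close>, the divisibility conditions do not depend on the chosen form.\<close>

lemma el_in_sub_iff:
  assumes "e dvd n" and "f dvd m"
  shows "el j i \<in> sub e f \<longleftrightarrow> e dvd j \<and> int f dvd i"
proof
  assume "el j i \<in> sub e f"
  then obtain l k where lk: "el j i = el l k" "e dvd l" "int f dvd k"
    by (auto simp: sub_def)
  \<comment> \<open>Cancelling \<open>el l k\<close> from both sides, with
    \<open>l * (n - 1)\<close> in place of \<open>- l\<close>, leaves a trivial element whose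
    exponents compare \<open>j\<close> with \<open>l\<close> and \<open>i\<close> with
    \<open>k\<close>.\<close>
  have "el (l * (n - 1) + j) (i - k) = el (l * (n - 1)) 0 \<otimes> el j i \<otimes> el 0 (- k)"
    by (simp add: el_mult)
  also have "\<dots> = el (l * (n - 1) + l) 0"
    unfolding lk(1) by (simp add: el_mult)
  also have "l * (n - 1) + l = l * n"
    using n_pos by (cases n) auto
  finally have "el (l * (n - 1) + j) (i - k) = \<one>"
    by (simp add: el_eq_one)
  then have "n dvd l * (n - 1) + j" "int m dvd i - k"
    using el_one_imp by blast+
  then have "e dvd l * (n - 1) + j" "int f dvd i - k"
    using assms by (auto intro: dvd_trans)
  then show "e dvd j \<and> int f dvd i"
    using lk by (metis dvd_add_right_iff dvd_mult2 diff_add_cancel dvd_add)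
qed (auto simp: sub_def)

text \<open>Membership of \<open>el j 0\<close> and \<open>el 0 i\<close> recovers the multiples of
  \<open>e\<close> and of \<open>f\<close>, hence \<open>e\<close> and \<open>f\<close>
  themselves.\<close>

lemma inj_on_sub: "inj_on (\<lambda>(e, f). sub e f) {(e, f). e dvd n \<and> f dvd m}"
proof (rule inj_onI, clarsimp)
  fix e f e' f'
  assume h: "sub e f = sub e' f'" "e dvd n" "f dvd m" "e' dvd n" "f' dvd m"
  have "e dvd j \<and> int f dvd i \<longleftrightarrow> e' dvd j \<and> int f' dvd i" for j i
    using el_in_sub_iff h by metis
  then show "e = e' \<and> f = f'"
    by (metis dvd_0_right dvd_antisym dvd_refl int_dvd_int_iff)
qed

lemma r_pow_mult: "[r ^ (n * l) = 1] (mod int m)"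
  using cong_pow[OF r_pow, of l] by (simp add: power_mult)

text \<open>Conjugation by \<open>el l k\<close> fixes the exponent \<open>j\<close> and, up to a
  power of \<open>r\<close>, adds \<open>k * (r ^ j - 1)\<close> to the exponent \<open>i\<close>.
  This summand is divisible by \<open>f\<close> because \<open>e\<close> divides
  \<open>j\<close>.\<close>

lemma normal_sub:
  assumes e: "e dvd n" and f: "f dvd m" and ef: "int f dvd r ^ e - 1"
  shows "sub e f \<lhd> G"
  unfolding normal_inv_iff
proof (intro conjI ballI)
  show "subgroup (sub e f) G"
  proof (rule subgroupI)
    show "sub e f \<noteq> {}" unfolding sub_def by (auto intro: exI[of _ 0])
    show "sub e f \<subseteq> carrier G" by (auto simp: sub_def)
    show "inv x \<in> sub e f" if "x \<in> sub e f" for x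
    proof -
      obtain j i where "x = el j i" "e dvd j" "int f dvd i"
        using \<open>x \<in> sub e f\<close> by (auto simp: sub_def)
      then show ?thesis by (simp add: inv_el el_in_sub_iff[OF e f])
    qed
    show "x \<otimes> y \<in> sub e f" if xy: "x \<in> sub e f" "y \<in> sub e f" for x y
    proof -
      obtain j i where "x = el j i" "e dvd j" "int f dvd i"
        using xy by (auto simp: sub_def)
      moreover obtain l k where "y = el l k" "e dvd l" "int f dvd k"
        using xy by (auto simp: sub_def)
      ultimately show ?thesis by (simp add: el_mult el_in_sub_iff[OF e f])
    qed
  qed
next
  fix x h assume x: "x \<in> carrier G" and h: "h \<in> sub e f"
  obtain l k where lk: "x = el l k" using carrier_el[OF x] by blast
  obtain j i where ji: "h = el j i" "e dvd j" "int f dvd i"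
    using h by (auto simp: sub_def)
  \<comment> \<open>Solution of \<open>i' * r ^ l + k = k * r ^ j + i\<close> modulo
    \<open>m\<close>, which expresses \<open>x \<otimes> h = el j i' \<otimes> x\<close>; the factor
    \<open>r ^ (l * (n - 1))\<close> is the inverse of \<open>r ^ l\<close> modulo
    \<open>m\<close>.\<close>
  define i' where "i' = (k * (r ^ j - 1) + i) * r ^ (l * (n - 1))"
  have f': "int f dvd i'"
    using dvd_power_minus_one_of_dvd[OF ef ji(2)] ji(3) by (simp add: i'_def)
  have nl: "l * (n - 1) + l = n * l"
    using n_pos by (cases n) auto
  have "i' * r ^ l + k = (k * (r ^ j - 1) + i) * r ^ (n * l) + k"
    by (simp add: i'_def mult.assoc flip: nl power_add)
  also have "[\<dots> = (k * (r ^ j - 1) + i) * 1 + k] (mod int m)"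
    by (intro cong_add cong_mult cong_refl r_pow_mult)
  finally have c: "[i' * r ^ l + k = k * r ^ j + i] (mod int m)"
    by (simp add: algebra_simps)
  have "x \<otimes> h = el (l + j) (k * r ^ j + i)"
    by (simp add: lk ji(1) el_mult)
  also have "\<dots> = el j i' \<otimes> x"
    unfolding lk el_mult using pow_a_cong[OF c] by (simp add: el_def add.commute)
  finally have "x \<otimes> h \<otimes> inv x = el j i'"
    using x by (simp add: inv_solve_right' ji(1))
  then show "x \<otimes> h \<otimes> inv x \<in> sub e f"
    using f' ji(2) by (simp add: el_in_sub_iff[OF e f])
qed

lemma normal_eq_sub:
  assumes N: "N \<lhd> G"
  obtains e f where "e dvd n" and "f dvd m" and "int f dvd r ^ e - 1" and "N = sub e f"
proof -
  have sg: "subgroup N G" using N by (simp add: normal_imp_subgroup)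
  have cnj: "inv x \<otimes> h \<otimes> x \<in> N" if "x \<in> carrier G" "h \<in> N" for x h
    using normal.inv_op_closed1[OF N that] .
  have mult_iff: "x \<otimes> y \<in> N \<longleftrightarrow> y \<in> N" if "x \<in> N" "y \<in> carrier G" for x y
    using subgroup_mult_left_iff[OF sg that] .
  have one: "\<one> \<in> N" using sg by (rule subgroup.one_closed)
  \<comment> \<open>\<open>e\<close> and \<open>f\<close> are the periods of the exponents
    \<open>j\<close> for which \<open>b [^] j\<close>, respectively \<open>a [^] j\<close>, lies in
    \<open>N\<close>.\<close>
  obtain e where e: "e dvd n" "\<And>j. b [^] j \<in> N \<longleftrightarrow> e dvd j"
    by (rule ex_period_dvd_iff[of "\<lambda>j. b [^] j \<in> N" n])
      (use n_pos one mult_iff in \<open>auto simp: pow_b nat_pow_mult[symmetric]\<close>)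
  obtain f where f: "f dvd m" "\<And>j. a [^] j \<in> N \<longleftrightarrow> f dvd j" for j :: nat
    by (rule ex_period_dvd_iff[of "\<lambda>j. a [^] j \<in> N" m])
      (use m_pos one mult_iff in \<open>auto simp: pow_a nat_pow_mult[symmetric]\<close>)
  \<comment> \<open>Passage from natural to integer exponents by reduction modulo \<open>m\<close>,
    which preserves divisibility by the divisor \<open>f\<close> of \<open>m\<close>.\<close>
  have fi: "a [^] i \<in> N \<longleftrightarrow> int f dvd i" for i :: int
  proof -
    have nn: "int (nat (i mod int m)) = i mod int m" using m_pos by simp
    have "a [^] i = a [^] (i mod int m)" by (rule pow_a_cong) (simp add: cong_def)
    also have "\<dots> = a [^] nat (i mod int m)" by (metis nn int_pow_int)
    finally have "a [^] i \<in> N \<longleftrightarrow> int f dvd i mod int m"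
      by (metis f(2) nn int_dvd_int_iff)
    then show ?thesis using f(1) by (simp add: dvd_mod_iff)
  qed
  have cop: "coprime (int f) (r - 1)"
    using coprime_r f(1) by (meson coprime_divisors dvd_refl int_dvd_int_iff)
  have el_N: "el j i \<in> N \<longleftrightarrow> e dvd j \<and> int f dvd i" for j i
  proof
    assume jN: "el j i \<in> N"
    \<comment> \<open>This isolates the commutator of \<open>el j i\<close> with \<open>b\<close>;
      it lies in \<open>N\<close>, and coprimality of \<open>f\<close> and \<open>r - 1\<close> then
      gives that \<open>f\<close> divides \<open>i\<close>.\<close>
    have "el j i \<otimes> b = b \<otimes> (el j i \<otimes> a [^] (i * (r - 1)))"
      using el_mult[of j i 1 0] el_mult[of 1 0 j i] el_mult[of j i 0 "i * (r - 1)"]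
        el_mult[of 1 0 j "i + i * (r - 1)"]
      by (simp add: el_def algebra_simps)
    then have "inv b \<otimes> el j i \<otimes> b = el j i \<otimes> a [^] (i * (r - 1))"
      by (simp add: m_assoc inv_solve_left')
    then have "a [^] (i * (r - 1)) \<in> N"
      using cnj[OF b_closed jN] mult_iff[OF jN] by simp
    then have fd: "int f dvd i"
      using cop by (simp add: fi coprime_dvd_mult_left_iff)
    then have "a [^] (- i) \<in> N" by (simp add: fi)
    then have "el j i \<otimes> a [^] (- i) \<in> N"
      using jN sg by (simp add: subgroup.m_closed)
    then have "b [^] j \<in> N"
      using el_mult[of j i 0 "- i"] by (simp add: el_def)
    with fd show "e dvd j \<and> int f dvd i" by (simp add: e(2))
  next
    assume "e dvd j \<and> int f dvd i"
    then show "el j i \<in> N"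
      unfolding el_def using e(2) fi sg by (simp add: subgroup.m_closed)
  qed
  have "int f dvd r ^ e - 1"
  proof -
    \<comment> \<open>The commutator of \<open>b [^] e\<close> with \<open>a\<close> is
      \<open>a [^] (1 - r ^ e)\<close>, so this power of \<open>a\<close> lies in
      \<open>N\<close>.\<close>
    have bN: "b [^] e \<in> N" by (simp add: e(2))
    have "b [^] e \<otimes> a = a \<otimes> (b [^] e \<otimes> a [^] (1 - r ^ e))"
      using el_mult[of e 0 0 1] el_mult[of 0 1 e "1 - r ^ e"] by (simp add: el_def)
    then have "inv a \<otimes> b [^] e \<otimes> a = b [^] e \<otimes> a [^] (1 - r ^ e)"
      by (simp add: m_assoc inv_solve_left')
    then have "a [^] (1 - r ^ e) \<in> N"
      using cnj[OF a_closed bN] mult_iff[OF bN] by simp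
    then show ?thesis by (simp add: fi dvd_diff_commute)
  qed
  moreover have "N = sub e f"
  proof (rule Set.set_eqI)
    fix x
    show "x \<in> N \<longleftrightarrow> x \<in> sub e f"
    proof (cases "x \<in> carrier G")
      case True
      then show ?thesis
        using carrier_el el_N el_in_sub_iff[OF e(1) f(1)] by metis
    next
      case False
      then show ?thesis
        using subgroup.mem_carrier[OF sg] by (auto simp: sub_def)
    qed
  qed
  ultimately show ?thesis using that e(1) f(1) by blast
qed

lemma card_normal_subgroups:
  "card (normal_subgroups G) = card {(e, f). e dvd n \<and> f dvd m \<and> int f dvd r ^ e - 1}"
proof -
  let ?S = "{(e, f). e dvd n \<and> f dvd m \<and> int f dvd r ^ e - 1}"
  have "normal_subgroups G = (\<lambda>(e, f). sub e f) ` ?S"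
    using normal_sub normal_eq_sub unfolding normal_subgroups_def by (auto simp: image_iff) metis
  moreover have "inj_on (\<lambda>(e, f). sub e f) ?S"
    by (rule inj_on_subset[OF inj_on_sub]) auto
  ultimately show ?thesis by (simp add: card_image)
qed

end

section \<open>The presentation\<close>

lemma (in group) word_eval_replicate:
  assumes "f x \<in> carrier G"
  shows "word_eval G f (replicate k (x, e)) = (if e then f x else inv f x) [^] k"
proof (induction k)
  case (Suc k)
  let ?g = "if e then f x else inv f x"
  have "word_eval G f (replicate (Suc k) (x, e)) = ?g \<otimes> word_eval G f (replicate k (x, e))"
    by (simp add: word_eval_def)
  also have "\<dots> = ?g [^] Suc k"
    unfolding Suc by (rule nat_pow_Suc2[symmetric]) (simp add: assms)
  finally show ?case .
qed (simp add: word_eval_def)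

lemma (in group) word_eval_gen_pow:
  assumes "f x \<in> carrier G"
  shows "word_eval G f (gen_pow x k) = f x [^] k"
proof -
  have eval: "word_eval G f (gen_pow x k) = (if k \<ge> 0 then f x else inv f x) [^] nat \<bar>k\<bar>"
    unfolding gen_pow_def by (rule word_eval_replicate[of f, OF assms])
  show ?thesis
  proof (cases "k \<ge> 0")
    case True
    then have "f x [^] nat k = f x [^] k" by (metis int_nat_eq int_pow_int)
    with True show ?thesis unfolding eval by simp
  next
    case False
    then have "inv (f x [^] nat (- k)) = f x [^] k"
      using int_pow_neg_int[OF assms, of "nat (- k)"] by simp
    with False show ?thesis unfolding eval by (simp add: nat_pow_inv[OF assms])
  qed
qed

lemma carrier_presented_groupE:
  assumes "A \<in> carrier (presented_group R)"
  obtains w where "A = word_cong R `` {w}"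
  using assms by (auto simp: presented_group_def quotient_def)

lemma class_in_carrier: "word_cong R `` {w} \<in> carrier (presented_group R)"
  by (simp add: presented_group_def quotientI)

text \<open>The class of a formal inverse letter is the inverse of the class of the letter, so
  evaluation agrees with concatenation letter by letter. Hence the classes of the generators satisfy
  the relations.\<close>

lemma word_eval_presented_group:
  "word_eval (presented_group R) (\<lambda>x. word_cong R `` {[(x, True)]}) w = word_cong R `` {w}"
proof (induction w)
  case Nil
  show ?case by (simp add: word_eval_def presented_group_def)
next
  case (Cons p w)
  interpret group "presented_group R" by (rule group_presented_group)
  obtain x e where p: "p = (x, e)" by force
  have "([(x, False), (x, True)], []) \<in> word_cong R"
    using word_cong.cancel[of x False R] by simp
  then have "word_cong R `` {[(x, False), (x, True)]} = \<one>\<^bsub>presented_group R\<^esub>"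
    by (simp add: presented_group_def equiv_class_eq[OF equiv_word_cong])
  then have "inv\<^bsub>presented_group R\<^esub> (word_cong R `` {[(x, True)]}) = word_cong R `` {[(x, False)]}"
    by (intro inv_equality) (simp_all add: mult_presented_group class_in_carrier)
  with Cons show ?case
    by (simp add: word_eval_def p mult_presented_group)
qed

lemma presented_group_relation:
  assumes "(u, v) \<in> R"
  shows "word_eval (presented_group R) (\<lambda>x. word_cong R `` {[(x, True)]}) u =
         word_eval (presented_group R) (\<lambda>x. word_cong R `` {[(x, True)]}) v"
  by (simp add: word_eval_presented_group equiv_class_eq[OF equiv_word_cong] word_cong.rel assms)

section \<open>A concrete model as a semidirect product\<close>

text \<open>The semidirect product of the residues modulo \<open>n\<close> and modulo
  \<open>m\<close>; the pair \<open>(j, i)\<close> stands for \<open>el j i\<close>, and the product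
  is that of \<open>el_mult\<close> with both components reduced.\<close>

definition zm_model :: "nat \<Rightarrow> nat \<Rightarrow> int \<Rightarrow> (nat \<times> int) monoid" where
  "zm_model m n r =
    \<lparr>carrier = {0..<n} \<times> {0..<int m},
     monoid.mult = (\<lambda>(j, i) (l, k). ((j + l) mod n, (i * r ^ l + k) mod int m)),
     one = (0, 0)\<rparr>"

text \<open>Dropping whole factors \<open>r ^ n\<close> changes nothing modulo \<open>m\<close>;
  this makes the multiplication of the model compatible with reducing exponents of \<open>b\<close>
  modulo \<open>n\<close>.\<close>

lemma pow_mod_exponent:
  assumes "[r ^ n = 1] (mod int m)"
  shows "[r ^ (l mod n) = r ^ l] (mod int m)"
proof -
  have "[r ^ (l mod n) * (r ^ n) ^ (l div n) = r ^ (l mod n) * 1 ^ (l div n)] (mod int m)"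
    by (intro cong_mult cong_pow cong_refl assms)
  then show ?thesis
    by (simp add: cong_sym flip: power_mult power_add)
qed

lemma group_zm_model:
  assumes m: "m \<ge> 1" and n: "n \<ge> 1" and r: "[r ^ n = 1] (mod int m)"
  shows "group (zm_model m n r)"
proof (rule groupI)
  let ?K = "zm_model m n r"
  show "x \<otimes>\<^bsub>?K\<^esub> y \<in> carrier ?K" if "x \<in> carrier ?K" "y \<in> carrier ?K" for x y
    using m n that by (auto simp: zm_model_def)
  show "\<one>\<^bsub>?K\<^esub> \<in> carrier ?K" using m n by (simp add: zm_model_def)
  show "\<one>\<^bsub>?K\<^esub> \<otimes>\<^bsub>?K\<^esub> x = x" if "x \<in> carrier ?K" for x
    using that by (auto simp: zm_model_def)
  show "x \<otimes>\<^bsub>?K\<^esub> y \<otimes>\<^bsub>?K\<^esub> z = x \<otimes>\<^bsub>?K\<^esub> (y \<otimes>\<^bsub>?K\<^esub> z)" for x y z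
  proof -
    obtain j i l k p q where xyz: "x = (j, i)" "y = (l, k)" "z = (p, q)"
      by (cases x, cases y, cases z)
    have "[((i * r ^ l + k) mod int m) * r ^ p + q = (i * r ^ l + k) * r ^ p + q] (mod int m)"
      by (intro cong_add cong_mult cong_refl) (simp add: cong_def)
    also have "(i * r ^ l + k) * r ^ p + q = i * r ^ (l + p) + (k * r ^ p + q)"
      by (simp add: algebra_simps power_add)
    also have "[\<dots> = i * r ^ ((l + p) mod n) + (k * r ^ p + q) mod int m] (mod int m)"
      by (intro cong_add cong_mult cong_refl cong_sym[OF pow_mod_exponent[OF r]])
        (simp add: cong_def)
    finally show ?thesis
      by (simp add: xyz zm_model_def cong_def mod_simps add.assoc)
  qed
  show "\<exists>y\<in>carrier ?K. y \<otimes>\<^bsub>?K\<^esub> x = \<one>\<^bsub>?K\<^esub>" if x: "x \<in> carrier ?K" for x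
  proof -
    obtain j i where ji: "x = (j, i)" "j < n" using x by (auto simp: zm_model_def)
    \<comment> \<open>The outer \<open>mod n\<close> covers \<open>j = 0\<close>, where
      \<open>n - j\<close> is \<open>n\<close> itself and lies outside the carrier.\<close>
    let ?y = "((n - j) mod n, (- i * r ^ (n - j)) mod int m)"
    have "[(- i * r ^ (n - j)) mod int m * r ^ j + i = - i * r ^ (n - j) * r ^ j + i] (mod int m)"
      by (intro cong_add cong_mult cong_refl) (simp add: cong_def)
    also have "- i * r ^ (n - j) * r ^ j + i = - i * r ^ n + i"
      using ji(2) by (simp add: mult.assoc flip: power_add)
    also have "[\<dots> = - i * 1 + i] (mod int m)"
      by (intro cong_add cong_mult cong_refl r)
    finally have "((- i * r ^ (n - j)) mod int m * r ^ j + i) mod int m = 0"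
      by (simp add: cong_def)
    moreover have "((n - j) mod n + j) mod n = 0"
      using ji(2) by (simp add: mod_simps)
    ultimately have "?y \<otimes>\<^bsub>?K\<^esub> x = \<one>\<^bsub>?K\<^esub>"
      by (simp add: ji(1) zm_model_def)
    moreover have "?y \<in> carrier ?K" using m n by (simp add: zm_model_def)
    ultimately show ?thesis by blast
  qed
qed

text \<open>The generator is written with \<open>1 mod int m\<close> so that it stays in the carrier
  when \<open>m = 1\<close>; \<open>1 mod n\<close> plays the same role for
  \<open>b\<close>.\<close>

lemma zm_model_pow_a:
  assumes m: "m \<ge> 1" and n: "n \<ge> 1" and r: "[r ^ n = 1] (mod int m)"
  shows "(0, 1 mod int m) [^]\<^bsub>zm_model m n r\<^esub> (i::int) = (0, i mod int m)"
proof -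
  interpret K: group "zm_model m n r" using assms by (rule group_zm_model)
  have nat: "(0, 1 mod int m) [^]\<^bsub>zm_model m n r\<^esub> k = (0, int k mod int m)" for k :: nat
    by (induction k) (simp_all add: zm_model_def mod_simps algebra_simps)
  have "inv\<^bsub>zm_model m n r\<^esub> (0, k mod int m) = (0, (- k) mod int m)" for k
    by (rule K.inv_equality) (use m n in \<open>simp_all add: zm_model_def mod_simps\<close>)
  then show ?thesis
    by (simp add: int_pow_def2 nat)
qed

lemma zm_model_pow_b:
  "(1 mod n, 0) [^]\<^bsub>zm_model m n r\<^esub> (j::nat) = (j mod n, 0)"
  by (induction j) (simp_all add: zm_model_def mod_simps)

lemma zm_relations_model:
  assumes m: "m \<ge> 1" and n: "n \<ge> 1" and r: "[r ^ n = 1] (mod int m)"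
  shows "zm_relations (zm_model m n r) (0, 1 mod int m) (1 mod n, 0) m n r"
proof -
  let ?K = "zm_model m n r"
  interpret K: group ?K using assms by (rule group_zm_model)
  have c: "(0, 1 mod int m) \<in> carrier ?K" "(1 mod n, 0) \<in> carrier ?K" "(0, r mod int m) \<in> carrier ?K"
    using m n by (simp_all add: zm_model_def)
  have one: "\<one>\<^bsub>?K\<^esub> = (0, 0)" by (simp add: zm_model_def)
  have "[1 mod int m * r ^ (1 mod n) = 1 * r ^ 1] (mod int m)"
    by (intro cong_mult pow_mod_exponent r) (simp add: cong_def)
  then have "(0, 1 mod int m) \<otimes>\<^bsub>?K\<^esub> (1 mod n, 0) = (1 mod n, 0) \<otimes>\<^bsub>?K\<^esub> (0, r mod int m)"
    by (simp add: zm_model_def cong_def)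
  then have "inv\<^bsub>?K\<^esub> (1 mod n, 0) \<otimes>\<^bsub>?K\<^esub> (0, 1 mod int m) \<otimes>\<^bsub>?K\<^esub> (1 mod n, 0) = (0, r mod int m)"
    using c by (simp add: K.m_assoc K.inv_solve_left')
  moreover have "(0, 1 mod int m) [^]\<^bsub>?K\<^esub> m = \<one>\<^bsub>?K\<^esub>" "(1 mod n, 0) [^]\<^bsub>?K\<^esub> n = \<one>\<^bsub>?K\<^esub>"
    unfolding one using zm_model_pow_a[OF assms, of "int m"] zm_model_pow_b[where j = n and n = n]
    by (simp_all only: int_pow_int mod_self)
  ultimately show ?thesis
    using c m n zm_model_pow_a[OF assms, of r] by unfold_locales simp_all
qed

lemma (in zm_relations) word_eval_relation:
  assumes "(u, v) \<in> {(gen_pow Gen_a (int m), []), (gen_pow Gen_b (int n), []),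
     (gen_pow Gen_b (-1) @ gen_pow Gen_a 1 @ gen_pow Gen_b 1, gen_pow Gen_a r)}"
  shows "word_eval G (case_zm_gen a b) u = word_eval G (case_zm_gen a b) v"
proof -
  let ?f = "case_zm_gen a b"
  have f: "?f x \<in> carrier G" for x by (cases x) auto
  have "word_eval G ?f [] = \<one>" by (simp add: word_eval_def)
  then show ?thesis
    using assms pow_a pow_b conj
    by (auto simp: word_eval_append[of ?f, OF f] word_eval_gen_pow int_pow_int int_pow_neg
        m_assoc)
qed

section \<open>Faithfulness of the presentation\<close>

text \<open>The relations bring every class into normal form; the homomorphism to the model shows
  that no further collapse occurs.\<close>

lemma zm_group_ZM:
  assumes m: "m \<ge> 1" and n: "n \<ge> 1" and cop: "coprime (int m) (r - 1)"
    and r: "[r ^ n = 1] (mod int m)"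
  obtains a b where "zm_group (ZM m n r) a b m n r"
proof -
  define R where "R = {(gen_pow Gen_a (int m), []), (gen_pow Gen_b (int n), []),
     (gen_pow Gen_b (-1) @ gen_pow Gen_a 1 @ gen_pow Gen_b 1, gen_pow Gen_a r)}"
  define P where "P = presented_group R"
  have P: "ZM m n r = P" by (simp add: ZM_def P_def R_def)
  interpret P: group P unfolding P_def by (rule group_presented_group)
  define c where "c x = word_cong R `` {[(x, True)]}" for x
  have c [simp]: "c x \<in> carrier P" for x
    by (simp add: c_def P_def class_in_carrier)
  have eval_c: "word_eval P c w = word_cong R `` {w}" for w
    unfolding P_def c_def[abs_def] by (rule word_eval_presented_group)
  have rel: "word_eval P c u = word_eval P c v" if "(u, v) \<in> R" for u v
    unfolding P_def c_def[abs_def] using that by (rule presented_group_relation)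
  have nil: "word_eval P c [] = \<one>\<^bsub>P\<^esub>" by (simp add: word_eval_def)
  have "c Gen_a [^]\<^bsub>P\<^esub> m = \<one>\<^bsub>P\<^esub>" "c Gen_b [^]\<^bsub>P\<^esub> n = \<one>\<^bsub>P\<^esub>"
    using rel[of "gen_pow Gen_a (int m)" "[]"] rel[of "gen_pow Gen_b (int n)" "[]"]
    by (simp_all add: nil P.word_eval_gen_pow int_pow_int R_def)
  moreover have "inv\<^bsub>P\<^esub> c Gen_b \<otimes>\<^bsub>P\<^esub> c Gen_a \<otimes>\<^bsub>P\<^esub> c Gen_b = c Gen_a [^]\<^bsub>P\<^esub> r"
    using rel[of "gen_pow Gen_b (-1) @ gen_pow Gen_a 1 @ gen_pow Gen_b 1" "gen_pow Gen_a r"]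
    by (simp add: P.word_eval_append[of c, OF c] P.word_eval_gen_pow P.int_pow_neg P.m_assoc R_def)
  ultimately interpret P: zm_relations P "c Gen_a" "c Gen_b" m n r
    using m n by unfold_locales simp_all
  have cases_c: "case_zm_gen (c Gen_a) (c Gen_b) = c"
    by (rule ext) (simp split: zm_gen.split)
  let ?K = "zm_model m n r"
  let ?a = "(0, 1 mod int m) :: nat \<times> int" and ?b = "(1 mod n, 0) :: nat \<times> int"
  interpret K: zm_relations ?K ?a ?b m n r using m n r by (rule zm_relations_model)
  have closed: "case_zm_gen ?a ?b x \<in> carrier ?K" for x
    by (cases x) (use K.a_closed K.b_closed in simp_all)
  \<comment> \<open>The universal property applies because the generators of the model satisfy the
    relations.\<close>
  obtain h where h: "h \<in> hom P ?K" "\<And>w. h (word_cong R `` {w}) = word_eval ?K (case_zm_gen ?a ?b) w"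
    using K.presented_group_universal[of "case_zm_gen ?a ?b" R, OF closed]
      K.word_eval_relation unfolding P_def R_def by metis
  interpret h: group_hom P ?K h by unfold_locales (rule h(1))
  have h_gen: "h (c Gen_a) = ?a" "h (c Gen_b) = ?b"
    using K.a_closed K.b_closed by (simp_all add: c_def h(2) word_eval_def)
  have "zm_group P (c Gen_a) (c Gen_b) m n r"
  proof
    show "\<exists>j i. x = P.el j i" if x: "x \<in> carrier P" for x
    proof -
      obtain w where "x = word_cong R `` {w}"
        using x unfolding P_def by (rule carrier_presented_groupE)
      then show ?thesis
        using P.word_eval_eq_el[of w] by (simp add: cases_c eval_c)
    qed
    show "n dvd j \<and> int m dvd i" if "P.el j i = \<one>\<^bsub>P\<^esub>" for j i
    proof -
      \<comment> \<open>The image of \<open>el j i\<close> is \<open>(j mod n, i mod int m)\<close>,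
        so a trivial \<open>el j i\<close> has both residues zero.\<close>
      have "h (P.el j i) = ?b [^]\<^bsub>?K\<^esub> j \<otimes>\<^bsub>?K\<^esub> ?a [^]\<^bsub>?K\<^esub> i"
        by (simp add: P.el_def h.hom_nat_pow h.hom_int_pow h_gen)
      then have "h (P.el j i) = (j mod n, 0) \<otimes>\<^bsub>?K\<^esub> (0, i mod int m)"
        by (simp only: zm_model_pow_a[OF m n r] zm_model_pow_b)
      then have "(j mod n, i mod int m) = (0, 0)"
        using that h.hom_one by (simp add: zm_model_def)
      then show ?thesis by (simp add: dvd_eq_mod_eq_0)
    qed
  qed (fact cop r)+
  then show ?thesis using that by (simp add: P)
qed

section \<open>Counting\<close>

text \<open>Multiplication by \<open>d\<close> is a bijection from the divisors of
  \<open>n div d\<close> onto the divisors of \<open>n\<close> that are multiples of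
  \<open>d\<close>.\<close>

lemma tau_div:
  assumes "d dvd n" and "n \<ge> 1"
  shows "card {e. e dvd n \<and> d dvd e} = tau (n div d)"
proof -
  obtain k where k: "n = d * k" using assms(1) by blast
  have d: "d > 0" using assms by (auto intro: Nat.gr0I)
  have "{e. e dvd n \<and> d dvd e} = (*) d ` {e. e dvd k}"
    using d by (auto simp: k)
  moreover have "inj_on ((*) d) A" for A using d by (auto simp: inj_on_def)
  ultimately show ?thesis using d by (simp add: tau_def k card_image)
qed

theorem corollary3:
  fixes m n d :: nat and r :: int
  assumes "m \<ge> 1" and "n \<ge> 1"
    and "gcd m n = 1" and "gcd (int m) (r - 1) = 1"
    and "[r ^ n = 1] (mod int m)"
    and "d = (LEAST k. k \<ge> 1 \<and> [r ^ k = 1] (mod int m))"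
  shows "(prime m \<longrightarrow> card (normal_subgroups (ZM m n r)) = tau n + tau (n div d)) \<and>
         (prime n \<longrightarrow> card (normal_subgroups (ZM m n r)) = tau m + 1)"
proof -
  let ?S = "{(e, f). e dvd n \<and> f dvd m \<and> int f dvd r ^ e - 1}"
  have cop: "coprime (int m) (r - 1)" using assms(4) by (simp add: coprime_iff_gcd_eq_1)
  obtain a b where "zm_group (ZM m n r) a b m n r"
    using zm_group_ZM[OF assms(1,2) cop assms(5)] .
  then have card: "card (normal_subgroups (ZM m n r)) = card ?S"
    by (rule zm_group.card_normal_subgroups)
  have fin: "finite {e. e dvd k}" if "k \<ge> 1" for k :: nat
    using that by simp
  have "card ?S = tau n + tau (n div d)" if "prime m"
  proof -
    have order: "[r ^ j = 1] (mod int m) \<longleftrightarrow> d dvd j" for j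
      unfolding assms(6)
    proof (rule Least_period_dvd_iff[where P = "\<lambda>k. [r ^ k = 1] (mod int m)", OF _ assms(2,5)])
      fix i j assume "[r ^ i = 1] (mod int m)"
      then have "[r ^ (i + j) = r ^ j] (mod int m)"
        using cong_mult[of "r ^ i" 1 "int m" "r ^ j" "r ^ j"] by (simp add: power_add)
      then show "[r ^ (i + j) = 1] (mod int m) \<longleftrightarrow> [r ^ j = 1] (mod int m)"
        by (metis cong_sym cong_trans)
    qed
    then have dn: "d dvd n" using assms(5) by blast
    \<comment> \<open>For \<open>m\<close> prime, \<open>f\<close> is 1 or \<open>m\<close>. The
      value 1 leaves \<open>e\<close> free, while \<open>m\<close> requires \<open>r ^ e = 1\<close>
      modulo \<open>m\<close>, that is, \<open>d dvd e\<close>. The two pieces are disjoint since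
      \<open>m\<close> differs from 1.\<close>
    have S: "?S = {e. e dvd n} \<times> {1} \<union> {e. e dvd n \<and> d dvd e} \<times> {m}"
      using that order by (auto simp: prime_nat_iff cong_iff_dvd_diff)
    have "m \<noteq> 1" using that by auto
    then show ?thesis unfolding S
      by (subst card_Un_disjoint)
        (use fin assms(2) tau_div[OF dn assms(2)] in
          \<open>auto simp: card_cartesian_product tau_def\<close>)
  qed
  moreover have "card ?S = tau m + 1" if "prime n"
  proof -
    \<comment> \<open>For \<open>n\<close> prime, \<open>e\<close> is 1 or \<open>n\<close>. If
      \<open>e = 1\<close>, coprimality of \<open>m\<close> and \<open>r - 1\<close> forces
      \<open>f = 1\<close>; if \<open>e = n\<close>, every divisor \<open>f\<close> of
      \<open>m\<close> qualifies.\<close>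
    have "f = 1" if "f dvd m" "int f dvd r - 1" for f
      using coprime_common_divisor[OF cop, of "int f"] that by simp
    moreover have "int f dvd r ^ n - 1" if "f dvd m" for f
      using assms(5) that by (meson cong_iff_dvd_diff dvd_trans int_dvd_int_iff)
    moreover have "e dvd n \<longleftrightarrow> e = n \<or> e = 1" for e
      using that by (auto simp: prime_nat_iff)
    ultimately have S: "?S = {n} \<times> {f. f dvd m} \<union> {(1, 1)}"
      by fastforce
    have "n \<noteq> 1" using that by auto
    then show ?thesis unfolding S
      by (subst card_Un_disjoint)
        (use fin[OF assms(1)] in \<open>auto simp: card_cartesian_product tau_def\<close>)
  qed
  ultimately show ?thesis by (simp add: card)
qed

end
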